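(* Suppose $p \colon \mathbb{N} \to (1,\infty)$ is an order function, and let $r \colon \mathbb{N} \to \mathbb{N}$ be any order function such that $\lim_{n \to \infty} r(n)/2^n = \infty$. Let $F\colon\mathbb{N}\to\mathbb{N}$ be $F(n)=\sum_{i < r(n)}\lfloor \log_2 p(i) \rfloor$. Then $$\mathrm{COMPLEX}\bigl(F^{\mathrm{inv}}\bigr) \leq_{\mathrm{s}} \mathrm{LUA}(p).$$
   Context: An order function is a computable (i.e. its values are uniformly computable reals), nondecreasing, unbounded function $\mathbb{N}\to\mathbb{R}$. For nondecreasing unbounded $F\colon\mathbb{N}\to\mathbb{R}$, $F^{\mathrm{inv}}(x)$ is the least $m\in\mathbb{N}$ with $F(m)\geq x$; here it is regarded as a function $\mathbb{N}\to\mathbb{N}$. Prefix-free complexity: a prefix-free machine is a partial recursive $M$ from $\{0,1\}^*$ to $\{0,1\}^*$ with prefix-free domain; $U$ is universal if for each prefix-free machine $M$ there is $\rho$ with $U(\rho^\frown\tau)\simeq M(\tau)$ for all $\tau$. Fix a universal $U$ and let $K(\sigma)=\min\{|\tau| : U(\tau)=\sigma\}$. For $f\colon\mathbb{N}\to\mathbb{R}$, $\mathrm{COMPLEX}(f)$ is the set of $X\in\{0,1\}^{\mathbb{N}}$ for which there is $c\in\mathbb{N}$ with $K(X\upharpoonright n)\geq f(n)-c$ for all $n$. A partial recursive $\psi\colon\subseteq\mathbb{N}\to\mathbb{N}$ is linearly universal if for every partial recursive $\theta\colon\subseteq\mathbb{N}\to\mathbb{N}$ there are $a,b\in\mathbb{N}$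 with $\psi(ax+b)\simeq\theta(x)$ for all $x$. For $p\colon\mathbb{N}\to(1,\infty)$, $\mathrm{LUA}(p)$ is the set of $X\in\mathbb{N}^{\mathbb{N}}$ such that $X(n)<p(n)$ for all $n$ and, for some linearly universal partial recursive $\psi$, there is no $n\in\operatorname{dom}\psi$ with $X(n)=\psi(n)$. For $P,Q\subseteq\mathbb{N}^{\mathbb{N}}$, $P\leq_{\mathrm{s}}Q$ means there is a partial recursive functional defined on all of $Q$ that maps $Q$ into $P$. *)

theory Defs
  imports Complex_Main "HOL-Library.Sublist"
begin

text \<open>
  Kleene's schemata, with a parameter \<open>X\<close> carried along uniformly. A functional of arity \<open>n\<close> is
  evaluated on argument lists of length \<open>n\<close>; its values on lists of other lengths are irrelevant,
  which is what rule \<open>ext\<close> expresses. The set \<open>B\<close> contains additional initial functionals: \<open>B = {}\<close>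
  yields the partial recursive functions, and \<open>B = {id}\<close> (so that \<open>X\<close> itself, a total function, is
  available as an oracle) yields the partial recursive functionals.
\<close>

fun primrec_op :: "(nat list \<Rightarrow> nat option) \<Rightarrow> (nat list \<Rightarrow> nat option) \<Rightarrow> nat \<Rightarrow> nat list \<Rightarrow> nat option"
  where
    "primrec_op f g 0 xs = f xs"
  | "primrec_op f g (Suc k) xs = Option.bind (primrec_op f g k xs) (\<lambda>v. g (k # v # xs))"

definition mu_op :: "(nat list \<Rightarrow> nat option) \<Rightarrow> nat list \<Rightarrow> nat option" where
  "mu_op f xs =
     (if \<exists>k. f (k # xs) = Some 0 \<and> (\<forall>j<k. \<exists>v. f (j # xs) = Some (Suc v))
      then Some (LEAST k. f (k # xs) = Some 0) else None)"

inductive murec :: "('x \<Rightarrow> nat \<Rightarrow> nat) set \<Rightarrow> nat \<Rightarrow> ('x \<Rightarrow> nat list \<Rightarrow> nat option) \<Rightarrow> bool"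
  for B :: "('x \<Rightarrow> nat \<Rightarrow> nat) set" where
  initial: "h \<in> B \<Longrightarrow> murec B 1 (\<lambda>X xs. Some (h X (hd xs)))"
| zero: "murec B n (\<lambda>X xs. Some 0)"
| successor: "murec B 1 (\<lambda>X xs. Some (Suc (hd xs)))"
| proj: "i < n \<Longrightarrow> murec B n (\<lambda>X xs. Some (xs ! i))"
| comp: "murec B (length gs) f \<Longrightarrow> (\<forall>g\<in>set gs. murec B n g) \<Longrightarrow>
    murec B n (\<lambda>X xs. Option.bind (those (map (\<lambda>g. g X xs) gs)) (f X))"
| prim: "murec B n f \<Longrightarrow> murec B (n + 2) g \<Longrightarrow>
    murec B (Suc n) (\<lambda>X xs. primrec_op (f X) (g X) (hd xs) (tl xs))"
| mu: "murec B (Suc n) f \<Longrightarrow> murec B n (\<lambda>X. mu_op (f X))"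
| ext: "murec B n f \<Longrightarrow> (\<And>X xs. length xs = n \<Longrightarrow> g X xs = f X xs) \<Longrightarrow> murec B n g"

definition partial_recursive :: "nat \<Rightarrow> (nat list \<Rightarrow> nat option) \<Rightarrow> bool" where
  "partial_recursive n f \<longleftrightarrow> murec {} n (\<lambda>_ :: unit. f)"

definition partial_recursive1 :: "(nat \<rightharpoonup> nat) \<Rightarrow> bool" where
  "partial_recursive1 f \<longleftrightarrow> partial_recursive 1 (\<lambda>xs. f (hd xs))"

definition recursive2 :: "(nat \<Rightarrow> nat \<Rightarrow> nat) \<Rightarrow> bool" where
  "recursive2 f \<longleftrightarrow> partial_recursive 2 (\<lambda>xs. Some (f (xs ! 0) (xs ! 1)))"

text \<open>
  The partial functional from Baire space to itself determined by \<open>\<Phi>\<close> sends \<open>X\<close> to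
  \<open>\<lambda>n. \<Phi> X [n]\<close> and is defined at \<open>X\<close> iff all these values are.
\<close>

definition partial_recursive_functional :: "((nat \<Rightarrow> nat) \<Rightarrow> nat list \<Rightarrow> nat option) \<Rightarrow> bool" where
  "partial_recursive_functional \<Phi> \<longleftrightarrow> murec {id} 1 \<Phi>"

definition strongly_reducible :: "(nat \<Rightarrow> nat) set \<Rightarrow> (nat \<Rightarrow> nat) set \<Rightarrow> bool"
    (infix "\<le>\<^sub>s" 50) where
  "P \<le>\<^sub>s Q \<longleftrightarrow>
     (\<exists>\<Phi>. partial_recursive_functional \<Phi> \<and> (\<forall>X\<in>Q. \<exists>Y\<in>P. \<forall>n. \<Phi> X [n] = Some (Y n)))"

text \<open>
  Rationals are presented as \<open>(a - b) / (c + 1)\<close> with \<open>a\<close>, \<open>b\<close>, \<open>c\<close> natural numbers.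
\<close>

definition uniformly_computable :: "(nat \<Rightarrow> real) \<Rightarrow> bool" where
  "uniformly_computable f \<longleftrightarrow>
     (\<exists>a b c. recursive2 a \<and> recursive2 b \<and> recursive2 c \<and>
        (\<forall>n k. \<bar>f n - (real (a n k) - real (b n k)) / (real (c n k) + 1)\<bar> \<le> 1 / 2 ^ k))"

definition order_function :: "(nat \<Rightarrow> real) \<Rightarrow> bool" where
  "order_function f \<longleftrightarrow> uniformly_computable f \<and> mono f \<and> \<not> bdd_above (range f)"

definition Finv :: "(nat \<Rightarrow> real) \<Rightarrow> nat \<Rightarrow> nat" where
  "Finv F x = (LEAST m. F m \<ge> real x)"

text \<open>
  Bijective base-2 numeration (least significant digit first), used to transfer recursiveness to
  binary strings.
\<close>

fun str_code :: "bool list \<Rightarrow> nat" where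
  "str_code [] = 0"
| "str_code (b # \<sigma>) = 2 * str_code \<sigma> + (if b then 2 else 1)"

lemma bij_str_code: "bij str_code"
proof (rule bijI)
  show "inj str_code"
  proof (rule injI)
    fix \<sigma> \<tau> :: "bool list"
    show "str_code \<sigma> = str_code \<tau> \<Longrightarrow> \<sigma> = \<tau>"
    proof (induction \<sigma> arbitrary: \<tau>)
      case Nil
      then show ?case by (cases \<tau>) (auto split: if_splits)
    next
      case (Cons b \<sigma>)
      show ?case
      proof (cases \<tau>)
        case Nil
        with Cons.prems show ?thesis by (auto split: if_splits)
      next
        case (Cons b' \<tau>')
        with Cons.prems have "b = b' \<and> str_code \<sigma> = str_code \<tau>'"
          by (auto split: if_splits) presburger+
        with Cons.IH Cons show ?thesis by auto
      qed
    qed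
  qed
  have "\<exists>\<sigma>. str_code \<sigma> = n" for n
  proof (induction n rule: less_induct)
    case (less n)
    show ?case
    proof (cases "n = 0")
      case True
      then show ?thesis by (intro exI[of _ "[]"]) simp
    next
      case False
      then have "(n - 1) div 2 < n" by linarith
      with less obtain \<sigma> where "str_code \<sigma> = (n - 1) div 2" by blast
      then have "str_code (even n # \<sigma>) = n" using False by (auto elim!: evenE oddE)
      then show ?thesis by blast
    qed
  qed
  then show "surj str_code" by (metis surjI)
qed

definition partial_recursive_str :: "(bool list \<rightharpoonup> bool list) \<Rightarrow> bool" where
  "partial_recursive_str M \<longleftrightarrow>
     (\<exists>f. partial_recursive1 f \<and> (\<forall>\<tau>. f (str_code \<tau>) = map_option str_code (M \<tau>)))"

definition prefix_free_machine :: "(bool list \<rightharpoonup> bool list) \<Rightarrow> bool" where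
  "prefix_free_machine M \<longleftrightarrow>
     partial_recursive_str M \<and> (\<forall>\<sigma>\<in>dom M. \<forall>\<tau>\<in>dom M. prefix \<sigma> \<tau> \<longrightarrow> \<sigma> = \<tau>)"

definition universal_prefix_free :: "(bool list \<rightharpoonup> bool list) \<Rightarrow> bool" where
  "universal_prefix_free U \<longleftrightarrow> prefix_free_machine U \<and>
     (\<forall>M. prefix_free_machine M \<longrightarrow> (\<exists>\<rho>. \<forall>\<tau>. U (\<rho> @ \<tau>) = M \<tau>))"

text \<open>
  For universal \<open>U\<close> every string is a value of \<open>U\<close>, so the minimum is attained.
\<close>

definition K :: "(bool list \<rightharpoonup> bool list) \<Rightarrow> bool list \<Rightarrow> nat" where
  "K U \<sigma> = (LEAST n. \<exists>\<tau>. length \<tau> = n \<and> U \<tau> = Some \<sigma>)"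

text \<open>
  Cantor space is the subset of Baire space consisting of the 0-1-valued functions.
\<close>

definition initial_segment :: "(nat \<Rightarrow> nat) \<Rightarrow> nat \<Rightarrow> bool list" where
  "initial_segment X n = map (\<lambda>i. X i = 1) [0..<n]"

definition COMPLEX :: "(bool list \<rightharpoonup> bool list) \<Rightarrow> (nat \<Rightarrow> real) \<Rightarrow> (nat \<Rightarrow> nat) set" where
  "COMPLEX U f =
     {X. (\<forall>n. X n \<in> {0, 1}) \<and>
         (\<exists>c :: nat. \<forall>n. real (K U (initial_segment X n)) \<ge> f n - real c)}"

definition linearly_universal :: "(nat \<rightharpoonup> nat) \<Rightarrow> bool" where
  "linearly_universal \<psi> \<longleftrightarrow> partial_recursive1 \<psi> \<and>
     (\<forall>\<theta>. partial_recursive1 \<theta> \<longrightarrow> (\<exists>a b. \<forall>x. \<psi> (a * x + b) = \<theta> x))"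

definition LUA :: "(nat \<Rightarrow> real) \<Rightarrow> (nat \<Rightarrow> nat) set" where
  "LUA p =
     {X. (\<forall>n. real (X n) < p n) \<and>
         (\<exists>\<psi>. linearly_universal \<psi> \<and> \<not> (\<exists>n\<in>dom \<psi>. \<psi> n = Some (X n)))}"

end

theory Submission
  imports Defs
begin

text \<open>
  Write \<open>m\<^sub>i = \<lfloor>log\<^sub>2 p(i)\<rfloor>\<close>. Concatenating self-delimiting codes of the values \<open>X(i)\<close>, of
  length at most \<open>2m\<^sub>i + 3\<close>, turns \<open>X \<in> LUA(p)\<close> into a 0-1-sequence \<open>Y\<close>. Since \<open>m\<close> is
  nondecreasing and eventually positive, the first \<open>s\<close> codes occupy at most \<open>\<Sum>i<6s. m\<^sub>i\<close> bits
  once \<open>s\<close> is large, so a prefix of \<open>Y\<close> longer than \<open>F(n)\<close> determines \<open>X(i)\<close> for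
  \<open>i < r(n) / 6\<close>. Let \<open>\<theta>\<close> be the partial recursive function that parses its argument \<open>x\<close> as
  \<open>1\<^sup>a01\<^sup>b0\<tau>\<close> and decodes the value number \<open>ax + b\<close> from \<open>U(\<tau>)\<close>. Because \<open>x\<close> carries
  \<open>(a, b)\<close> along, no recursion theorem is needed: if \<open>\<psi>(ax + b) \<simeq> \<theta>(x)\<close> and \<open>U(\<tau>)\<close> is a prefix
  of \<open>Y\<close> longer than \<open>F(n)\<close> with \<open>|\<tau>| \<le> n\<close>, then \<open>ax + b = O(2\<^sup>n)\<close>, hence \<open>ax + b < r(n) / 6\<close>
  for large \<open>n\<close>, and \<open>\<psi>(ax + b) = X(ax + b)\<close>.
\<close>

section \<open>Total recursive functionals\<close>

text \<open>Total functionals are singled out so that closure rules act on plain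
  \<open>nat\<close>-valued terms and can be chained by \<open>intro\<close>.\<close>

definition recursive_in ::
    "('x \<Rightarrow> nat \<Rightarrow> nat) set \<Rightarrow> nat \<Rightarrow> ('x \<Rightarrow> nat list \<Rightarrow> nat) \<Rightarrow> bool" where
  "recursive_in B n f \<longleftrightarrow> murec B n (\<lambda>X xs. Some (f X xs))"

lemma recursive_in_cong:
  assumes "recursive_in B n f" and "\<And>X xs. length xs = n \<Longrightarrow> g X xs = f X xs"
  shows "recursive_in B n g"
  unfolding recursive_in_def
  by (rule murec.ext[OF assms(1)[unfolded recursive_in_def]]) (simp add: assms(2))

lemma those_map_Some: "those (map (\<lambda>g. Some (h g)) gs) = Some (map h gs)"
  by (induction gs) auto

lemma recursive_in_comp:
  assumes "recursive_in B (length gs) f" and "\<forall>g\<in>set gs. recursive_in B n g"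
  shows "recursive_in B n (\<lambda>X xs. f X (map (\<lambda>g. g X xs) gs))"
proof -
  have "murec B n (\<lambda>X xs. Option.bind
      (those (map (\<lambda>g. g X xs) (map (\<lambda>g X xs. Some (g X xs)) gs))) (\<lambda>ys. Some (f X ys)))"
    by (rule murec.comp[where f = "\<lambda>X ys. Some (f X ys)"])
      (use assms in \<open>auto simp: recursive_in_def\<close>)
  then show ?thesis
    by (simp add: recursive_in_def o_def those_map_Some)
qed

lemma recursive_in_comp1:
  assumes "recursive_in B 1 (\<lambda>X xs. f X (xs ! 0))" and "recursive_in B n a"
  shows "recursive_in B n (\<lambda>X xs. f X (a X xs))"
  using recursive_in_comp[of B "[a]" "\<lambda>X xs. f X (xs ! 0)" n] assms by simp

lemma recursive_in_comp2:
  assumes "recursive_in B 2 (\<lambda>X xs. f X (xs ! 0) (xs ! 1))"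
    and "recursive_in B n a" "recursive_in B n b"
  shows "recursive_in B n (\<lambda>X xs. f X (a X xs) (b X xs))"
  using recursive_in_comp[of B "[a, b]" "\<lambda>X xs. f X (xs ! 0) (xs ! 1)" n] assms
  by (simp add: numeral_2_eq_2)

lemma recursive_in_proj: "i < n \<Longrightarrow> recursive_in B n (\<lambda>X xs. xs ! i)"
  unfolding recursive_in_def by (rule murec.proj)

lemma recursive_in_Suc:
  assumes "recursive_in B n a"
  shows "recursive_in B n (\<lambda>X xs. Suc (a X xs))"
proof (rule recursive_in_comp1[of B "\<lambda>X. Suc", OF _ assms])
  have "recursive_in B 1 (\<lambda>X xs. Suc (hd xs))"
    unfolding recursive_in_def by (rule murec.successor)
  then show "recursive_in B 1 (\<lambda>X xs. Suc (xs ! 0))"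
    by (rule recursive_in_cong) (metis One_nat_def hd_conv_nth length_0_conv n_not_Suc_n)
qed

lemma recursive_in_const: "recursive_in B n (\<lambda>X xs. c)"
proof (induction c)
  case 0
  show ?case unfolding recursive_in_def by (rule murec.zero)
next
  case (Suc c)
  then show ?case by (rule recursive_in_Suc)
qed

lemma recursive_in_initial:
  assumes "h \<in> B" and "recursive_in B n a"
  shows "recursive_in B n (\<lambda>X xs. h X (a X xs))"
proof (rule recursive_in_comp1[OF _ assms(2)])
  have "recursive_in B 1 (\<lambda>X xs. h X (hd xs))"
    unfolding recursive_in_def using assms(1) by (rule murec.initial)
  then show "recursive_in B 1 (\<lambda>X xs. h X (xs ! 0))"
    by (rule recursive_in_cong) (metis One_nat_def hd_conv_nth length_0_conv n_not_Suc_n)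
qed

lemma recursive_in_rec:
  assumes f: "recursive_in B 1 (\<lambda>X xs. f X (xs ! 0))"
    and g: "recursive_in B 3 (\<lambda>X xs. g X (xs ! 0) (xs ! 1) (xs ! 2))"
    and ab: "recursive_in B n a" "recursive_in B n b"
  shows "recursive_in B n (\<lambda>X xs. rec_nat (f X (b X xs)) (\<lambda>k v. g X k v (b X xs)) (a X xs))"
proof (rule recursive_in_comp2[OF _ ab])
  let ?f = "\<lambda>X xs. Some (f X (xs ! 0))"
  let ?g = "\<lambda>X xs. Some (g X (xs ! 0) (xs ! 1) (xs ! 2))"
  have "murec B (Suc 1) (\<lambda>X xs. primrec_op (?f X) (?g X) (hd xs) (tl xs))"
    by (rule murec.prim) (use f g in \<open>simp_all add: recursive_in_def numeral_3_eq_3\<close>)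
  moreover have "primrec_op (?f X) (?g X) k ys =
      Some (rec_nat (f X (ys ! 0)) (\<lambda>k v. g X k v (ys ! 0)) k)" for X k ys
    by (induction k) (simp_all add: numeral_2_eq_2)
  ultimately have "recursive_in B 2
      (\<lambda>X xs. rec_nat (f X (tl xs ! 0)) (\<lambda>k v. g X k v (tl xs ! 0)) (hd xs))"
    by (simp add: recursive_in_def numeral_2_eq_2)
  then show "recursive_in B 2
      (\<lambda>X xs. rec_nat (f X (xs ! 1)) (\<lambda>k v. g X k v (xs ! 1)) (xs ! 0))"
    by (rule recursive_in_cong) (auto simp: numeral_2_eq_2 length_Suc_conv)
qed

text \<open>For total \<open>f\<close> the requirement in \<open>mu_op\<close> that earlier values
  be positive is automatic at the least zero.\<close>

lemma mu_op_Some: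
  "mu_op (\<lambda>xs. Some (f xs)) xs =
     (if \<exists>k. f (k # xs) = 0 then Some (LEAST k. f (k # xs) = 0) else None)"
proof -
  have "\<exists>k. f (k # xs) = 0 \<and> (\<forall>j<k. \<exists>v. f (j # xs) = Suc v)" if "\<exists>k. f (k # xs) = 0"
  proof (intro exI conjI allI impI)
    show "f ((LEAST k. f (k # xs) = 0) # xs) = 0" using that by (rule LeastI_ex)
    fix j assume "j < (LEAST k. f (k # xs) = 0)"
    then have "f (j # xs) \<noteq> 0" by (rule not_less_Least)
    then show "f (j # xs) = Suc (f (j # xs) - 1)" by simp
  qed
  then have "(\<exists>k. f (k # xs) = 0 \<and> (\<forall>j<k. \<exists>v. f (j # xs) = Suc v)) \<longleftrightarrow>
      (\<exists>k. f (k # xs) = 0)"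
    by blast
  then show ?thesis by (simp add: mu_op_def)
qed

text \<open>Existence of a zero makes the search total. Truncated subtraction satisfies u - v = 0
  iff u \<le> v, so the searches below can state their bounds in this form.\<close>

lemma recursive_in_Least:
  assumes f: "recursive_in B 2 (\<lambda>X xs. f X (xs ! 0) (xs ! 1))"
    and ex: "\<And>X y. \<exists>k. f X k y = 0"
    and a: "recursive_in B n a"
  shows "recursive_in B n (\<lambda>X xs. LEAST k. f X k (a X xs) = 0)"
proof (rule recursive_in_comp1[of B "\<lambda>X y. LEAST k. f X k y = 0", OF _ a])
  have "murec B 1 (\<lambda>X. mu_op (\<lambda>xs. Some (f X (xs ! 0) (xs ! 1))))"
    by (rule murec.mu) (use f in \<open>simp add: recursive_in_def numeral_2_eq_2\<close>)
  then show "recursive_in B 1 (\<lambda>X xs. LEAST k. f X k (xs ! 0) = 0)"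
    unfolding recursive_in_def by (rule murec.ext) (simp add: ex mu_op_Some)
qed

section \<open>Arithmetic and case distinction\<close>

lemma recursive_in_add:
  assumes "recursive_in B n a" "recursive_in B n b"
  shows "recursive_in B n (\<lambda>X xs. a X xs + b X xs)"
proof -
  have eq: "x + y = rec_nat y (\<lambda>k v. Suc v) x" for x y :: nat
    by (induction x) auto
  show ?thesis unfolding eq
    by (rule recursive_in_rec[where f = "\<lambda>X y. y" and g = "\<lambda>X k v y. Suc v"])
      (intro assms recursive_in_Suc recursive_in_proj; simp)+
qed

lemma recursive_in_mult:
  assumes "recursive_in B n a" "recursive_in B n b"
  shows "recursive_in B n (\<lambda>X xs. a X xs * b X xs)"
proof -
  have eq: "x * y = rec_nat 0 (\<lambda>k v. v + y) x" for x y :: nat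
    by (induction x) auto
  show ?thesis unfolding eq
    by (rule recursive_in_rec[where f = "\<lambda>X y. 0" and g = "\<lambda>X k v y. v + y"])
      (auto intro!: assms recursive_in_add recursive_in_proj recursive_in_const)
qed

lemma recursive_in_diff:
  assumes "recursive_in B n a" "recursive_in B n b"
  shows "recursive_in B n (\<lambda>X xs. a X xs - b X xs)"
proof -
  have pred: "x - 1 = rec_nat 0 (\<lambda>k v. k) x" for x :: nat
    by (induction x) auto
  have rec_pred: "recursive_in B 3 (\<lambda>X xs. xs ! 1 - 1)" unfolding pred
    by (rule recursive_in_rec[where f = "\<lambda>X y. 0" and g = "\<lambda>X k v y. k" and b = "\<lambda>X xs. 0"])
      (auto intro!: recursive_in_proj recursive_in_const)
  have eq: "rec_nat x (\<lambda>k v. v - 1) y = x - y" for x y :: nat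
    by (induction y) auto
  have "recursive_in B n (\<lambda>X xs. rec_nat (a X xs) (\<lambda>k v. v - 1) (b X xs))"
    by (rule recursive_in_rec[where f = "\<lambda>X y. y" and g = "\<lambda>X k v y. v - 1"])
      (use rec_pred in \<open>auto intro: assms recursive_in_proj\<close>)
  then show ?thesis unfolding eq .
qed

lemmas recursive_in_arith =
  recursive_in_proj recursive_in_Suc recursive_in_const recursive_in_add recursive_in_mult
  recursive_in_diff

lemma recursive_in_if:
  assumes "recursive_in B n c" "recursive_in B n a" "recursive_in B n b"
  shows "recursive_in B n (\<lambda>X xs. if c X xs = 0 then a X xs else b X xs)"
proof -
  \<comment> \<open>By truncation \<open>1 - c\<close> is the indicator of c = 0, and
    \<open>1 - (1 - c)\<close> that of c > 0.\<close>
  have "recursive_in B n (\<lambda>X xs. (1 - c X xs) * a X xs + (1 - (1 - c X xs)) * b X xs)"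
    by (intro recursive_in_arith assms)
  then show ?thesis by (rule recursive_in_cong) auto
qed

section \<open>Operations on codes of strings\<close>

text \<open>A nonzero code is 2q + 1 or 2q + 2 with q the code of the tail, so q is the least number
  with n \<le> 2q + 2. The code 0 of the empty string is sent to itself.\<close>

definition tl_code :: "nat \<Rightarrow> nat" where
  "tl_code n = (LEAST q. n - (2 * q + 2) = 0)"

definition drop_code :: "nat \<Rightarrow> nat \<Rightarrow> nat" where
  "drop_code n j = rec_nat n (\<lambda>_ v. tl_code v) j"

text \<open>With q the code of its tail, the code of a nonempty suffix is 2q + 1 plus its first bit.
  Past the end of the string truncation gives 0, so the search in \<open>leading_ones\<close> always
  stops.\<close>

definition bit_at :: "nat \<Rightarrow> nat \<Rightarrow> nat" where
  "bit_at n j = drop_code n j - (2 * drop_code n (Suc j) + 1)"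

definition len_code :: "nat \<Rightarrow> nat" where
  "len_code n = (LEAST j. drop_code n j = 0)"

definition leading_ones :: "nat \<Rightarrow> nat" where
  "leading_ones n = (LEAST j. bit_at n j = 0)"

lemma tl_code_eq: "tl_code n = (n - 1) div 2"
  unfolding tl_code_def by (rule Least_equality) auto

lemma drop_code_0 [simp]: "drop_code n 0 = n"
  and drop_code_Suc: "drop_code n (Suc j) = (drop_code n j - 1) div 2"
  by (simp_all add: drop_code_def tl_code_eq)

lemma drop_code_add: "drop_code n (i + j) = drop_code (drop_code n i) j"
  by (induction j) (simp_all add: drop_code_Suc)

lemma bit_at_drop_code: "bit_at (drop_code n i) j = bit_at n (i + j)"
  by (simp add: bit_at_def drop_code_add flip: add_Suc_right)

lemma drop_code_eq_0: "n < 2 ^ j \<Longrightarrow> drop_code n j = 0"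
proof (induction j arbitrary: n)
  case (Suc j)
  have "drop_code n (Suc j) = drop_code (tl_code n) j"
    using drop_code_add[of n 1 j] by (simp add: drop_code_Suc tl_code_eq)
  moreover have "tl_code n < 2 ^ j" using Suc.prems by (simp add: tl_code_eq)
  ultimately show ?case using Suc.IH by simp
qed simp

lemma drop_code_self: "drop_code n n = 0"
  by (rule drop_code_eq_0) (rule less_exp)

lemma bit_at_self: "bit_at n n = 0"
  by (simp add: bit_at_def drop_code_self)

lemma drop_code_str_code: "drop_code (str_code \<sigma>) j = str_code (drop j \<sigma>)"
proof (induction j)
  case (Suc j)
  show ?case
  proof (cases "drop j \<sigma>")
    case (Cons b \<tau>)
    then have "drop (Suc j) \<sigma> = \<tau>" by (metis drop_Suc list.sel(3) tl_drop)
    then show ?thesis using Suc Cons by (simp add: drop_code_Suc)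
  qed (use Suc in \<open>simp add: drop_code_Suc\<close>)
qed simp

lemma bit_at_str_code:
  "bit_at (str_code \<sigma>) j = (if j < length \<sigma> \<and> \<sigma> ! j then 1 else 0)"
proof (cases "j < length \<sigma>")
  case True
  then have "drop j \<sigma> = \<sigma> ! j # drop (Suc j) \<sigma>" by (rule Cons_nth_drop_Suc[symmetric])
  then show ?thesis using True by (simp add: bit_at_def drop_code_str_code)
qed (simp add: bit_at_def drop_code_str_code)

lemma str_code_less: "str_code \<sigma> < 2 ^ Suc (length \<sigma>)"
proof -
  \<comment> \<open>The added 2 makes the induction work: 2c + 2 + 2 = 2(c + 2).\<close>
  have "str_code \<sigma> + 2 \<le> 2 ^ Suc (length \<sigma>)" by (induction \<sigma>) auto
  then show ?thesis by linarith
qed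

lemma leading_ones_eqI:
  assumes "\<And>j. j < w \<Longrightarrow> bit_at n j = 1" and "bit_at n w = 0"
  shows "leading_ones n = w"
  unfolding leading_ones_def
  by (rule Least_equality) (use assms in \<open>auto simp: not_less[symmetric]\<close>)

lemma recursive_in_drop_code:
  assumes "recursive_in B n a" "recursive_in B n b"
  shows "recursive_in B n (\<lambda>X xs. drop_code (a X xs) (b X xs))"
proof -
  have "recursive_in B 3 (\<lambda>X xs. tl_code (xs ! 1))"
    unfolding tl_code_def
  proof (rule recursive_in_Least[where f = "\<lambda>X q y. y - (2 * q + 2)"])
    show "recursive_in B 2 (\<lambda>X xs. xs ! 1 - (2 * xs ! 0 + 2))"
      by (intro recursive_in_arith) auto
    show "\<exists>q. y - (2 * q + 2) = 0" for y :: nat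
      by (rule exI[of _ y]) simp
  qed (simp add: recursive_in_proj)
  then show ?thesis
    unfolding drop_code_def
    by (intro recursive_in_rec[where f = "\<lambda>X y. y" and g = "\<lambda>X k v y. tl_code v"])
      (auto intro!: assms recursive_in_proj)
qed

lemma recursive_in_bit_at:
  assumes "recursive_in B n a" "recursive_in B n b"
  shows "recursive_in B n (\<lambda>X xs. bit_at (a X xs) (b X xs))"
  unfolding bit_at_def by (intro recursive_in_arith recursive_in_drop_code assms)

lemma recursive_in_len_code:
  assumes "recursive_in B n a"
  shows "recursive_in B n (\<lambda>X xs. len_code (a X xs))"
  unfolding len_code_def
  by (rule recursive_in_Least[where f = "\<lambda>X j y. drop_code y j"])
    (auto intro!: recursive_in_drop_code recursive_in_proj drop_code_self assms)

lemma recursive_in_leading_ones: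
  assumes "recursive_in B n a"
  shows "recursive_in B n (\<lambda>X xs. leading_ones (a X xs))"
  unfolding leading_ones_def
  by (rule recursive_in_Least[where f = "\<lambda>X j y. bit_at y j"])
    (auto intro!: recursive_in_bit_at recursive_in_proj bit_at_self assms)

section \<open>The sequence of codes\<close>

text \<open>
  The code of \<open>v = str_code \<sigma>\<close> is \<open>1\<^sup>w 0 \<sigma>\<^sup>R\<close>, where \<open>w = |\<sigma>|\<close>. The reversal makes decoding
  a primitive recursion that needs no powers of 2.
\<close>

definition block_bit :: "nat \<Rightarrow> nat \<Rightarrow> nat" where
  "block_bit v t =
     (if Suc t - len_code v = 0 then 1 else if t - len_code v = 0 then 0
      else bit_at v (2 * len_code v - t))"

definition block_start :: "(nat \<Rightarrow> nat) \<Rightarrow> nat \<Rightarrow> nat" where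
  "block_start X i = rec_nat 0 (\<lambda>j v. v + (2 * len_code (X j) + 1)) i"

text \<open>The number of the block that contains position n.\<close>

definition block_index :: "(nat \<Rightarrow> nat) \<Rightarrow> nat \<Rightarrow> nat" where
  "block_index X n = (LEAST i. Suc n - block_start X (Suc i) = 0)"

definition block_stream :: "(nat \<Rightarrow> nat) \<Rightarrow> nat \<Rightarrow> nat" where
  "block_stream X n =
     block_bit (X (block_index X n)) (n - block_start X (block_index X n))"

text \<open>Horner's scheme: each bit read is put in front of the string coded so far, so a reversed
  string comes out in its original order.\<close>

definition read_bits :: "nat \<Rightarrow> nat \<Rightarrow> nat" where
  "read_bits m w = rec_nat 0 (\<lambda>j v. 2 * v + 1 + bit_at m j) w"

text \<open>A block with w leading ones has length 2w + 1, so blocks can be skipped without knowing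
  the encoded sequence.\<close>

definition drop_blocks :: "nat \<Rightarrow> nat \<Rightarrow> nat" where
  "drop_blocks m i = rec_nat m (\<lambda>_ u. drop_code u (2 * leading_ones u + 1)) i"

definition decode_block :: "nat \<Rightarrow> nat \<Rightarrow> nat" where
  "decode_block m i =
     read_bits (drop_code (drop_blocks m i) (Suc (leading_ones (drop_blocks m i))))
       (leading_ones (drop_blocks m i))"

lemma block_start_Suc: "block_start X (Suc i) = block_start X i + (2 * len_code (X i) + 1)"
  by (simp add: block_start_def)

lemma block_start_mono: "i \<le> j \<Longrightarrow> block_start X i \<le> block_start X j"
  by (rule lift_Suc_mono_le) (simp_all add: block_start_Suc)

lemma block_start_eq_sum: "block_start X i = (\<Sum>j<i. 2 * len_code (X j) + 1)"
  by (induction i) (simp_all add: block_start_def)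

lemma block_start_ge: "i \<le> block_start X i"
  by (induction i) (simp_all add: block_start_Suc)

lemma bit_at_le_1: "bit_at n j \<le> 1"
  unfolding bit_at_def drop_code_Suc by linarith

lemma block_stream_01: "block_stream X n \<in> {0, 1}"
  using bit_at_le_1 by (simp add: block_stream_def block_bit_def le_Suc_eq)

section \<open>Recursiveness of the encoding and the decoding\<close>

lemma recursive_in_block_bit:
  assumes "recursive_in B n a" "recursive_in B n b"
  shows "recursive_in B n (\<lambda>X xs. block_bit (a X xs) (b X xs))"
  unfolding block_bit_def
  by (intro recursive_in_if recursive_in_arith recursive_in_bit_at recursive_in_len_code assms)

lemma recursive_in_block_start:
  assumes "recursive_in {id} n a"
  shows "recursive_in {id} n (\<lambda>X xs. block_start X (a X xs))"
proof -
  have id: "recursive_in {id} 3 (\<lambda>X xs. X (xs ! 0))"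
    using recursive_in_initial[of id "{id}" 3 "\<lambda>X xs. xs ! 0"] by (simp add: recursive_in_proj)
  have "recursive_in {id} 3 (\<lambda>X xs. xs ! 1 + (2 * len_code (X (xs ! 0)) + 1))"
    by (intro recursive_in_arith recursive_in_len_code id) auto
  then show ?thesis
    unfolding block_start_def
    by (intro recursive_in_rec[where f = "\<lambda>X y. 0" and b = "\<lambda>X xs. 0"
          and g = "\<lambda>X k v y. v + (2 * len_code (X k) + 1)"])
      (auto intro!: assms recursive_in_const)
qed

lemma recursive_in_block_stream: "recursive_in {id} 1 (\<lambda>X xs. block_stream X (xs ! 0))"
proof -
  have index: "recursive_in {id} 1 (\<lambda>X xs. block_index X (xs ! 0))"
    unfolding block_index_def
  proof (rule recursive_in_Least[where f = "\<lambda>X i y. Suc y - block_start X (Suc i)"])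
    show "recursive_in {id} 2 (\<lambda>X xs. Suc (xs ! 1) - block_start X (Suc (xs ! 0)))"
      by (intro recursive_in_arith recursive_in_block_start) auto
    \<comment> \<open>Every block, even that of the value 0, has at least one bit, so the search for
      the block stops.\<close>
    show "\<exists>k. Suc y - block_start X (Suc k) = 0" for X y
      using block_start_ge[of "Suc y" X] by auto
  qed (auto intro!: recursive_in_proj)
  have "recursive_in {id} 1 (\<lambda>X xs. X (block_index X (xs ! 0)))"
    using recursive_in_initial[OF _ index, of id] by simp
  then show ?thesis
    unfolding block_stream_def
    by (intro recursive_in_block_bit recursive_in_arith recursive_in_block_start index) auto
qed

lemma recursive_in_decode_block:
  assumes "recursive_in B n a" "recursive_in B n b"
  shows "recursive_in B n (\<lambda>X xs. decode_block (a X xs) (b X xs))"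
proof -
  have read: "recursive_in B n (\<lambda>X xs. read_bits (c X xs) (d X xs))"
    if "recursive_in B n c" "recursive_in B n d" for c d
  proof -
    have "recursive_in B 3 (\<lambda>X xs. 2 * xs ! 1 + 1 + bit_at (xs ! 2) (xs ! 0))"
      by (intro recursive_in_arith recursive_in_bit_at) auto
    then show ?thesis
      unfolding read_bits_def
      by (intro recursive_in_rec[where f = "\<lambda>X y. 0" and g = "\<lambda>X j v m. 2 * v + 1 + bit_at m j"])
        (auto intro!: that recursive_in_const)
  qed
  have "recursive_in B 3 (\<lambda>X xs. drop_code (xs ! 1) (2 * leading_ones (xs ! 1) + 1))"
    by (intro recursive_in_arith recursive_in_drop_code recursive_in_leading_ones) auto
  then have "recursive_in B n (\<lambda>X xs. drop_blocks (a X xs) (b X xs))"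
    unfolding drop_blocks_def
    by (intro recursive_in_rec[where f = "\<lambda>X y. y"
          and g = "\<lambda>X k u y. drop_code u (2 * leading_ones u + 1)"])
      (auto intro!: assms recursive_in_proj)
  then show ?thesis
    unfolding decode_block_def
    by (intro read recursive_in_drop_code recursive_in_Suc recursive_in_leading_ones)
qed

section \<open>Correctness of the decoding\<close>

lemma block_stream_eq:
  assumes "t \<le> 2 * len_code (X i)"
  shows "block_stream X (block_start X i + t) = block_bit (X i) t"
proof -
  let ?n = "block_start X i + t"
  have "block_index X ?n = i"
    unfolding block_index_def
  proof (rule Least_equality)
    show "Suc ?n - block_start X (Suc i) = 0" using assms by (simp add: block_start_Suc)
    fix j assume "Suc ?n - block_start X (Suc j) = 0"
    then have "block_start X i < block_start X (Suc j)" by linarith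
    then show "i \<le> j" using block_start_mono[of "Suc j" i X] by linarith
  qed
  then show ?thesis by (simp add: block_stream_def)
qed

lemma len_code_nonzero: "j < len_code v \<Longrightarrow> drop_code v j \<noteq> 0"
  unfolding len_code_def by (rule not_less_Least)

lemma drop_code_len_code: "drop_code v (len_code v) = 0"
  unfolding len_code_def by (rule LeastI[of _ v]) (rule drop_code_self)

lemma read_bits_eq:
  assumes "\<And>t. t < len_code v \<Longrightarrow> bit_at m t = bit_at v (len_code v - Suc t)"
  shows "read_bits m (len_code v) = v"
proof -
  \<comment> \<open>After j bits the accumulator holds the suffix of length j of the string coded by
    \<open>v\<close>, as the reversed block delivers the last bit first.\<close>
  have "read_bits m j = drop_code v (len_code v - j)" if "j \<le> len_code v" for j
    using that
  proof (induction j)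
    case 0
    then show ?case by (simp add: read_bits_def drop_code_len_code)
  next
    case (Suc j)
    define i where "i = len_code v - Suc j"
    have i: "len_code v - j = Suc i" "i < len_code v" using Suc.prems by (simp_all add: i_def)
    have "read_bits m (Suc j) = 2 * drop_code v (Suc i) + 1 + bit_at v i"
      using Suc assms[of j] i by (simp add: read_bits_def i_def)
    also have "\<dots> = drop_code v i"
      using len_code_nonzero[OF i(2)] unfolding bit_at_def drop_code_Suc by linarith
    finally show ?case by (simp add: i_def)
  qed
  from this[of "len_code v"] show ?thesis by simp
qed

text \<open>By induction, skipping j \<le> i blocks lands exactly on the start of block j, where the
  leading ones reveal the length of the string to be read.\<close>

lemma decode_block_eq:
  assumes bits: "\<And>j. j < block_start X (Suc i) \<Longrightarrow> bit_at m j = block_stream X j"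
  shows "decode_block m i = X i"
proof -
  have block: "bit_at m (block_start X j + t) = block_bit (X j) t"
    if "j \<le> i" "t \<le> 2 * len_code (X j)" for j t
  proof -
    have "block_start X j + t < block_start X (Suc j)" using that by (simp add: block_start_Suc)
    also have "\<dots> \<le> block_start X (Suc i)" using that by (simp add: block_start_mono)
    finally show ?thesis using bits block_stream_eq that by simp
  qed
  have ones: "leading_ones (drop_code m (block_start X j)) = len_code (X j)" if "j \<le> i" for j
    by (rule leading_ones_eqI) (use block that in \<open>auto simp: bit_at_drop_code block_bit_def\<close>)
  have drop: "drop_blocks m j = drop_code m (block_start X j)" if "j \<le> i" for j
    using that
  proof (induction j)
    case 0
    show ?case by (simp add: drop_blocks_def block_start_def)
  next
    case (Suc j)
    then have "drop_blocks m (Suc j) =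
        drop_code (drop_code m (block_start X j)) (2 * len_code (X j) + 1)"
      using ones[of j] by (simp add: drop_blocks_def)
    then show ?case by (simp add: block_start_Suc flip: drop_code_add)
  qed
  have "read_bits (drop_code m (block_start X i + Suc (len_code (X i)))) (len_code (X i)) = X i"
  proof (rule read_bits_eq)
    fix t assume t: "t < len_code (X i)"
    have "bit_at (drop_code m (block_start X i + Suc (len_code (X i)))) t =
        bit_at m (block_start X i + (Suc (len_code (X i)) + t))"
      by (simp add: bit_at_drop_code add.assoc)
    also have "\<dots> = block_bit (X i) (Suc (len_code (X i)) + t)" using t by (intro block) auto
    also have "\<dots> = bit_at (X i) (len_code (X i) - Suc t)"
      using t by (simp add: block_bit_def mult_2)
    finally show "bit_at (drop_code m (block_start X i + Suc (len_code (X i)))) t =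
        bit_at (X i) (len_code (X i) - Suc t)" .
  qed
  then show ?thesis using ones[of i] drop[of i] by (simp add: decode_block_def flip: drop_code_add)
qed

lemma decode_initial_segment:
  assumes "block_start X (Suc i) \<le> k"
  shows "decode_block (str_code (initial_segment (block_stream X) k)) i = X i"
proof (rule decode_block_eq)
  fix j assume "j < block_start X (Suc i)"
  then show "bit_at (str_code (initial_segment (block_stream X) k)) j = block_stream X j"
    using assms block_stream_01[of X j] by (auto simp: bit_at_str_code initial_segment_def)
qed

text \<open>A block has length at most \<open>2 * m i + 3\<close>. The factor 6 provides six
  translates of i by multiples of s: by monotonicity \<open>m i + m (i + s)\<close> covers
  \<open>2 * m i\<close>, and the translates by 2s, 3s and 4s, where \<open>m\<close> is at least
  \<open>m s\<close>, hence at least 1, cover the 3.\<close>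

lemma block_start_le:
  fixes m :: "nat \<Rightarrow> nat"
  assumes X: "\<And>i. X i < 2 ^ Suc (m i)" and mono: "mono m" and pos: "m s \<ge> 1"
    and r: "6 * s \<le> r"
  shows "block_start X s \<le> (\<Sum>i<r. m i)"
proof -
  have len: "len_code (X i) \<le> Suc (m i)" for i
    unfolding len_code_def by (rule Least_le) (rule drop_code_eq_0[OF X])
  have "block_start X s \<le> (\<Sum>i<s. 2 * m i + 3)"
    unfolding block_start_eq_sum
  proof (rule sum_mono)
    fix i show "2 * len_code (X i) + 1 \<le> 2 * m i + 3" using len[of i] by linarith
  qed
  also have "\<dots> \<le> (\<Sum>i<s. m i + m (i + s) + m (i + 2 * s) + m (i + 3 * s) + m (i + 4 * s)
      + m (i + 5 * s))"
  proof (rule sum_mono)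
    fix i
    have "m i \<le> m (i + s)" "m s \<le> m (i + 2 * s)"
      "m s \<le> m (i + 3 * s)" "m s \<le> m (i + 4 * s)"
      by (auto intro!: monoD[OF mono])
    then show "2 * m i + 3 \<le> m i + m (i + s) + m (i + 2 * s) + m (i + 3 * s) + m (i + 4 * s)
      + m (i + 5 * s)" using pos by linarith
  qed
  also have "\<dots> = (\<Sum>i<6 * s. m i)"
  proof -
    have "(\<Sum>i<k * s + s. m i) = (\<Sum>i<k * s. m i) + (\<Sum>i<s. m (i + k * s))" for k
      using sum.atLeastLessThan_concat[of 0 "k * s" "k * s + s" m]
        sum.shift_bounds_nat_ivl[of m 0 "k * s" s]
      by (simp add: lessThan_atLeast0 add.commute)
    from this[of 1] this[of 2] this[of 3] this[of 4] this[of 5] show ?thesis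
      by (simp add: sum.distrib flip: mult_2)
  qed
  also have "\<dots> \<le> (\<Sum>i<r. m i)" using r by (intro sum_mono2) auto
  finally show ?thesis .
qed

section \<open>The partial recursive function and the universal machine\<close>

definition parse_code :: "nat \<Rightarrow> nat \<times> nat \<times> nat" where
  "parse_code x =
     (let y = drop_code x (Suc (leading_ones x))
      in (leading_ones x, leading_ones y, drop_code y (Suc (leading_ones y))))"

lemma parse_code_eq:
  "parse_code (str_code (replicate a True @ False # replicate b True @ False # \<tau>)) =
     (a, b, str_code \<tau>)"
proof -
  have ones: "leading_ones (str_code (replicate a True @ False # \<rho>)) = a" for a \<rho>
    by (rule leading_ones_eqI) (auto simp: bit_at_str_code nth_append)
  show ?thesis by (simp add: parse_code_def Let_def ones drop_code_str_code)
qed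

text \<open>Only \<open>f\<close> is partial: the result is a total decoder applied to the value
  \<open>f y\<close> and the original argument x, from which a and b are read again.\<close>

lemma partial_recursive1_decode:
  assumes "partial_recursive1 f"
  shows "partial_recursive1
    (\<lambda>x. case parse_code x of (a, b, y) \<Rightarrow>
       Option.bind (f y) (\<lambda>m. Some (decode_block m (a * x + b))))"
proof -
  let ?y = "\<lambda>x. drop_code x (Suc (leading_ones x))"
  let ?t = "\<lambda>x. drop_code (?y x) (Suc (leading_ones (?y x)))"
  let ?G = "\<lambda>_ xs. decode_block (xs ! 0)
    (leading_ones (xs ! 1) * xs ! 1 + leading_ones (?y (xs ! 1)))"
  note rules = recursive_in_arith recursive_in_leading_ones recursive_in_drop_code
    recursive_in_decode_block
  have f: "murec {} 1 (\<lambda>_ :: unit. \<lambda>xs. f (hd xs))"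
    using assms by (simp add: partial_recursive1_def partial_recursive_def)
  have t: "recursive_in {} 1 (\<lambda>_ :: unit. \<lambda>xs. ?t (xs ! 0))"
    by (intro rules) auto
  have "murec {} 1 (\<lambda>X :: unit. \<lambda>xs. Option.bind
      (those (map (\<lambda>g. g X xs) [\<lambda>_ xs. Some (?t (xs ! 0))])) (\<lambda>xs. f (hd xs)))"
    using f t by (intro murec.comp[where f = "\<lambda>_ xs. f (hd xs)"]) (simp_all add: recursive_in_def)
  then have ft: "murec {} 1 (\<lambda>_ :: unit. \<lambda>xs. f (?t (xs ! 0)))" by simp
  have "recursive_in {} 2 (?G :: unit \<Rightarrow> _)" by (intro rules) auto
  then have "murec {} 1 (\<lambda>X :: unit. \<lambda>xs. Option.bind
      (those (map (\<lambda>g. g X xs) [\<lambda>_ xs. f (?t (xs ! 0)), \<lambda>_ xs. Some (xs ! 0)]))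
      (\<lambda>ys. Some (?G X ys)))"
    using ft by (intro murec.comp[where f = "\<lambda>X ys. Some (?G X ys)"])
      (auto simp: recursive_in_def numeral_2_eq_2 intro: murec.proj)
  then show ?thesis
    unfolding partial_recursive1_def partial_recursive_def
    by (rule murec.ext)
      (auto simp: parse_code_def Let_def length_Suc_conv split: Option.bind_split)
qed

section \<open>Prefix-free complexity\<close>

lemma universal_prefix_free_surj:
  assumes "universal_prefix_free U"
  shows "\<exists>\<tau>. U \<tau> = Some \<sigma>"
proof -
  \<comment> \<open>A machine halting only on the empty string is prefix-free; simulating it by
    \<open>U\<close> produces \<sigma>.\<close>
  let ?M = "[[] \<mapsto> \<sigma>] :: bool list \<rightharpoonup> bool list"
  let ?c = "str_code \<sigma>"
  \<comment> \<open>The value at [k, n] is |c - k| + n, which vanishes only for k = c and n = 0. So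
    the search returns c on 0, the code of the empty string, and diverges elsewhere.\<close>
  let ?g = "\<lambda>xs. (?c - xs ! 0) + (xs ! 0 - ?c) + xs ! 1"
  let ?f = "\<lambda>n. if n = 0 then Some ?c else None"
  have "recursive_in {} 2 (\<lambda>_ :: unit. ?g)" by (intro recursive_in_arith) auto
  then have "murec {} 1 (\<lambda>_ :: unit. mu_op (\<lambda>xs. Some (?g xs)))"
    by (intro murec.mu) (simp add: recursive_in_def numeral_2_eq_2)
  then have "partial_recursive1 ?f"
    unfolding partial_recursive1_def partial_recursive_def
  proof (rule murec.ext)
    fix xs :: "nat list" assume "length xs = 1"
    then obtain n where xs: "xs = [n]" by (auto simp: length_Suc_conv)
    have "(LEAST k. ?c - k = 0 \<and> k - ?c = 0) = ?c" by (rule Least_equality) auto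
    then show "?f (hd xs) = mu_op (\<lambda>xs. Some (?g xs)) xs"
      by (auto simp: xs mu_op_Some intro: exI[of _ ?c])
  qed
  moreover have "?f (str_code \<tau>) = map_option str_code (?M \<tau>)" for \<tau>
    by (cases \<tau>) auto
  ultimately have "prefix_free_machine ?M"
    unfolding prefix_free_machine_def partial_recursive_str_def
    by (intro conjI exI[of _ ?f]) auto
  then obtain \<rho> where "\<And>\<tau>. U (\<rho> @ \<tau>) = ?M \<tau>"
    using assms unfolding universal_prefix_free_def by blast
  then show ?thesis by (metis fun_upd_same)
qed

lemma K_attained:
  assumes "universal_prefix_free U"
  obtains \<tau> where "length \<tau> = K U \<sigma>" "U \<tau> = Some \<sigma>"
proof -
  obtain \<tau> where "U \<tau> = Some \<sigma>" using universal_prefix_free_surj[OF assms] by blast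
  then have "\<exists>n \<tau>. length \<tau> = n \<and> U \<tau> = Some \<sigma>" by blast
  from LeastI_ex[OF this] show ?thesis using that unfolding K_def by blast
qed

lemma less_Finv: "n < Finv F x \<Longrightarrow> F n < real x"
  unfolding Finv_def by (metis not_le not_less_Least)

section \<open>The reduction\<close>

theorem mainTheorem12:
  fixes U :: "bool list \<rightharpoonup> bool list"
    and p :: "nat \<Rightarrow> real"
    and r :: "nat \<Rightarrow> nat"
    and F :: "nat \<Rightarrow> nat"
  assumes "universal_prefix_free U"
    and "\<And>n. p n > 1"
    and "order_function p"
    and "order_function (\<lambda>n. real (r n))"
    and "filterlim (\<lambda>n. real (r n) / 2 ^ n) at_top sequentially"
    and "\<And>n. F n = (\<Sum>i<r n. nat \<lfloor>log 2 (p i)\<rfloor>)"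
  shows "COMPLEX U (\<lambda>n. real (Finv (\<lambda>m. real (F m)) n)) \<le>\<^sub>s LUA p"
proof -
  note U = assms(1) and p1 = assms(2) and F = assms(6)
  define m where "m i = nat \<lfloor>log 2 (p i)\<rfloor>" for i
  have p_mono: "mono p" and p_unbounded: "\<not> bdd_above (range p)"
    using assms(3) by (simp_all add: order_function_def)
  have m_mono: "mono m"
  proof (rule monoI)
    fix i j :: nat assume "i \<le> j"
    then have "log 2 (p i) \<le> log 2 (p j)"
      using monoD[OF p_mono, of i j] p1[of i] by simp
    then show "m i \<le> m j" unfolding m_def by (intro nat_mono floor_mono)
  qed
  \<comment> \<open>From N on, \<open>m\<close> is positive; the index s below is shifted by N for
    this reason.\<close>
  obtain N where "p N > 2" using p_unbounded by (meson bdd_aboveI2 not_le)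
  then have "1 \<le> log 2 (p N)" by simp
  then have mN: "m N \<ge> 1" by (simp add: m_def le_nat_iff le_floor_iff)
  have p_less: "p i < 2 ^ Suc (m i)" for i
  proof -
    have "log 2 (p i) < real (Suc (m i))"
      unfolding m_def using p1[of i] by simp linarith
    then have "p i < 2 powr real (Suc (m i))"
      using p1[of i] by (simp add: log_less_iff)
    then show ?thesis by (simp add: powr_realpow del: of_nat_Suc)
  qed
  obtain f where f: "partial_recursive1 f"
    and fU: "\<And>\<tau>. f (str_code \<tau>) = map_option str_code (U \<tau>)"
    using U unfolding universal_prefix_free_def prefix_free_machine_def partial_recursive_str_def
    by blast
  define \<theta> where "\<theta> x = (case parse_code x of (a, b, y) \<Rightarrow>
       Option.bind (f y) (\<lambda>m. Some (decode_block m (a * x + b))))" for x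
  have \<theta>: "partial_recursive1 \<theta>"
    unfolding \<theta>_def by (rule partial_recursive1_decode[OF f])
  have "block_stream X \<in> COMPLEX U (\<lambda>n. real (Finv (\<lambda>m. real (F m)) n))"
    if X_LUA: "X \<in> LUA p" for X
  proof -
    obtain \<psi> where Xp: "\<And>n. real (X n) < p n" and \<psi>: "linearly_universal \<psi>"
      and avoid: "\<And>n. \<psi> n \<noteq> Some (X n)"
      using X_LUA unfolding LUA_def by blast
    obtain a b where ab: "\<And>x. \<psi> (a * x + b) = \<theta> x"
      using \<psi> \<theta> unfolding linearly_universal_def by blast
    have X: "X i < 2 ^ Suc (m i)" for i
      using less_trans[OF Xp[of i] p_less[of i]] by (metis of_nat_less_numeral_power_cancel_iff)
    \<comment> \<open>The x below codes a string of length at most a + b + 2 + n, so x < 2^(a + b +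
      3) 2^n. Thus \<open>C * 2 ^ n\<close> bounds 6(ax + b + N + 1), with the 6 required by
      \<open>block_start_le\<close>.\<close>
    define C where "C = 6 * (a * 2 ^ (a + b + 3) + b + N + 1)"
    obtain c where c: "\<And>n. n \<ge> c \<Longrightarrow> real C \<le> real (r n) / 2 ^ n"
      using assms(5) unfolding filterlim_at_top eventually_sequentially by blast
    have r: "C * 2 ^ n \<le> r n" if "n \<ge> c" for n
    proof -
      have "real (C * 2 ^ n) \<le> real (r n)" using c[OF that] by (simp add: field_simps)
      then show ?thesis by linarith
    qed
    let ?F = "Finv (\<lambda>m. real (F m))"
    have "real (?F k) - real c \<le> real (K U (initial_segment (block_stream X) k))" for k
    proof (rule ccontr)
      let ?\<sigma> = "initial_segment (block_stream X) k"
      assume "\<not> ?thesis"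
      then have less: "K U ?\<sigma> + c < ?F k" by linarith
      \<comment> \<open>The predecessor of the least argument at which F reaches k, hence F n < k.
        Since K + c \<le> n, the single constant c yields both the growth bound for r at n and a
        description of length at most n.\<close>
      define n where "n = ?F k - 1"
      have n: "n < ?F k" "n \<ge> c" "K U ?\<sigma> \<le> n" using less by (simp_all add: n_def)
      have "F n < k" using less_Finv[OF n(1)] by simp
      obtain \<tau> where \<tau>: "length \<tau> = K U ?\<sigma>" "U \<tau> = Some ?\<sigma>" by (rule K_attained[OF U])
      define x where "x = str_code (replicate a True @ False # replicate b True @ False # \<tau>)"
      define pos where "pos = a * x + b"
      \<comment> \<open>\<open>Suc pos\<close> makes block \<open>pos\<close> complete, and N
        ensures \<open>m s \<ge> 1\<close>.\<close>
      define s where "s = Suc pos + N"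
      have "x < 2 ^ Suc (a + Suc (b + Suc (length \<tau>)))"
        unfolding x_def
        by (rule less_le_trans[OF str_code_less]) simp
      also have "\<dots> \<le> 2 ^ (a + b + 3 + n)"
        using n(3) \<tau>(1) by (intro power_increasing) auto
      finally have "a * x \<le> a * 2 ^ (a + b + 3) * 2 ^ n"
        by (simp add: power_add mult.assoc)
      moreover have "b + N + 1 \<le> (b + N + 1) * 2 ^ n"
        using mult_le_mono2[of 1 "2 ^ n" "b + N + 1"] by simp
      ultimately have "6 * (a * x + (b + N + 1)) \<le>
          6 * (a * 2 ^ (a + b + 3) * 2 ^ n + (b + N + 1) * 2 ^ n)"
        by (intro mult_le_mono2 add_mono)
      also have "\<dots> = C * 2 ^ n"
        by (simp add: C_def algebra_simps)
      finally have "6 * s \<le> C * 2 ^ n"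
        by (simp add: s_def pos_def)
      then have "6 * s \<le> r n" using r[OF n(2)] by linarith
      moreover have "m s \<ge> 1" using mN monoD[OF m_mono, of N s] by (simp add: s_def)
      ultimately have "block_start X s \<le> F n"
        using block_start_le[OF X m_mono] by (simp add: F m_def)
      then have "block_start X (Suc pos) \<le> k"
        using block_start_mono[of "Suc pos" s X] \<open>F n < k\<close> by (simp add: s_def)
      \<comment> \<open>The k bits output by \<open>U\<close> on \<tau> contain block
        \<open>pos\<close>. Parsing x returns a, b and \<tau>, so decoding recovers
        \<open>X pos\<close>, a value that \<psi> must avoid at \<open>pos\<close>.\<close>
      then have "\<theta> x = Some (X pos)"
        unfolding \<theta>_def
        by (simp add: x_def[THEN arg_cong, of parse_code] parse_code_eq fU \<tau>(2)
            decode_initial_segment flip: pos_def)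
      then show False using ab[of x] avoid[of pos] by (simp add: pos_def)
    qed
    then show ?thesis
      unfolding COMPLEX_def using block_stream_01 by blast
  qed
  moreover have "partial_recursive_functional (\<lambda>X xs. Some (block_stream X (xs ! 0)))"
    using recursive_in_block_stream
    by (simp add: partial_recursive_functional_def recursive_in_def)
  ultimately show ?thesis
    unfolding strongly_reducible_def by fastforce
qed

end
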